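(* Let $\mathbb{K}\in\{\mathbb{R},\mathbb{C}\}$. A homogeneous polynomial $f\in\mathbb{K}[x_1,\ldots,x_n]$ of degree 3 is equivalent over $\mathbb{K}$ to a sum of $n$ cubes if and only if its slices $T_1,\ldots,T_n$ span a matrix subspace containing a nonsingular matrix and there exists an invertible $Q\in M_n(\mathbb{K})$ such that all $n$ matrices $Q^TT_iQ$ are diagonal.
   Context: $f$ is equivalent over $\mathbb{K}$ to a sum of $n$ cubes if $f(x)=P_3(Ax)$ for some nonsingular $A\in M_n(\mathbb{K})$, where $P_3=x_1^3+\cdots+x_n^3$. The slices of a degree 3 form $f$: let $T_{ijk}=\frac16\,\partial^3 f/\partial x_i\partial x_j\partial x_k$; the $i$-th slice is the symmetric matrix $T_i$ with $(T_i)_{jk}=T_{ijk}$. *)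

theory Defs
  imports "HOL-Analysis.Analysis" "HOL-Library.Poly_Mapping"
begin

section \<open>Polynomials in finitely many variables\<close>

text \<open>
  The variables are indexed by a finite type \<open>'n\<close> with \<open>n = CARD('n)\<close> elements. A monomial is its
  exponent vector, and a polynomial maps monomials to coefficients; ring operations are the
  convolution operations of \<^theory>\<open>HOL-Library.Poly_Mapping\<close>.
\<close>

type_synonym ('a, 'n) mpoly = "('n \<Rightarrow>\<^sub>0 nat) \<Rightarrow>\<^sub>0 'a"

definition mconst :: "'a::zero \<Rightarrow> ('a, 'n) mpoly" where
  "mconst c = Poly_Mapping.single 0 c"

definition mvar :: "'n \<Rightarrow> ('a::zero_neq_one, 'n) mpoly" where
  "mvar i = Poly_Mapping.single (Poly_Mapping.single i 1) 1"

text \<open>As usual, the zero polynomial counts as homogeneous of every degree.\<close>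

definition homogeneous :: "nat \<Rightarrow> ('a::zero, 'n::finite) mpoly \<Rightarrow> bool" where
  "homogeneous d f \<longleftrightarrow>
     (\<forall>m\<in>Poly_Mapping.keys f. (\<Sum>i\<in>UNIV. Poly_Mapping.lookup m i) = d)"

text \<open>
  Formal partial derivative. Subtraction of exponent vectors is pointwise and truncated; where it
  truncates, the coefficient \<open>of_nat 0\<close> is zero.
\<close>

definition partial_deriv :: "'n \<Rightarrow> ('a::comm_semiring_1, 'n) mpoly \<Rightarrow> ('a, 'n) mpoly" where
  "partial_deriv i f =
     (\<Sum>m\<in>Poly_Mapping.keys f.
        Poly_Mapping.single (m - Poly_Mapping.single i 1)
          (of_nat (Poly_Mapping.lookup m i) * Poly_Mapping.lookup f m))"

definition msubst ::
    "('n::finite \<Rightarrow> ('a::comm_semiring_1, 'n) mpoly) \<Rightarrow> ('a, 'n) mpoly \<Rightarrow> ('a, 'n) mpoly" where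
  "msubst \<sigma> f =
     (\<Sum>m\<in>Poly_Mapping.keys f.
        mconst (Poly_Mapping.lookup f m) * (\<Prod>i\<in>UNIV. \<sigma> i ^ Poly_Mapping.lookup m i))"

text \<open>\<open>lin_subst A f\<close> is the polynomial \<open>f(Ax)\<close>.\<close>

definition lin_subst ::
    "'a::comm_semiring_1^'n::finite^'n \<Rightarrow> ('a, 'n) mpoly \<Rightarrow> ('a, 'n) mpoly" where
  "lin_subst A f = msubst (\<lambda>i. \<Sum>j\<in>UNIV. mconst (A $ i $ j) * mvar j) f"


section \<open>Sums of cubes and slices\<close>

definition sum_of_cubes :: "('a::comm_semiring_1, 'n::finite) mpoly" where
  "sum_of_cubes = (\<Sum>i\<in>UNIV. mvar i ^ 3)"

definition equivalent_to_sum_of_cubes :: "('a::comm_ring_1, 'n::finite) mpoly \<Rightarrow> bool" where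
  "equivalent_to_sum_of_cubes f \<longleftrightarrow>
     (\<exists>A :: 'a^'n^'n. invertible A \<and> f = lin_subst A sum_of_cubes)"

text \<open>
  For a form \<open>f\<close> of degree 3 the third partial derivatives are constant polynomials (see
  \<open>third_partial_deriv_constant\<close> below), and \<open>slice\<close> reads off the constant.
\<close>

definition slice :: "('a::field, 'n::finite) mpoly \<Rightarrow> 'n \<Rightarrow> 'a^'n^'n" where
  "slice f i = (\<chi> j k. 1 / 6 *
     Poly_Mapping.lookup (partial_deriv i (partial_deriv j (partial_deriv k f))) 0)"

definition diagonal_matrix :: "'a::zero^'n^'n \<Rightarrow> bool" where
  "diagonal_matrix D \<longleftrightarrow> (\<forall>i j. i \<noteq> j \<longrightarrow> D $ i $ j = 0)"

text \<open>
  Linear span of matrices over their own field of entries. The library constant \<^const>\<open>span\<close> is the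
  span over the reals, hence too small for complex matrices.
\<close>

definition mat_scale :: "'a::times \<Rightarrow> 'a^'n^'m \<Rightarrow> 'a^'n^'m" where
  "mat_scale c M = (\<chi> i j. c * M $ i $ j)"

definition mat_span :: "('a::comm_ring_1^'n^'m) set \<Rightarrow> ('a^'n^'m) set" where
  "mat_span = module.span mat_scale"


section \<open>Basic facts about these notions\<close>

lemma vector_space_mat_scale: "vector_space (mat_scale :: 'a::field \<Rightarrow> 'a^'n^'m \<Rightarrow> 'a^'n^'m)"
  by unfold_locales (simp_all add: mat_scale_def vec_eq_iff algebra_simps)

lemma mat_span_real: "(mat_span :: (real^'n^'m) set \<Rightarrow> _) = span"
proof -
  have "mat_scale = (scaleR :: real \<Rightarrow> real^'n^'m \<Rightarrow> _)"
    by (intro ext) (simp add: mat_scale_def vec_eq_iff)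
  then show ?thesis
    unfolding mat_span_def span_raw_def by simp
qed

lemma lookup_partial_deriv:
  "Poly_Mapping.lookup (partial_deriv i f) m =
     of_nat (Suc (Poly_Mapping.lookup m i)) * Poly_Mapping.lookup f (m + Poly_Mapping.single i 1)"
proof -
  let ?e = "Poly_Mapping.single i (1::nat)"
  let ?t = "\<lambda>k. of_nat (Poly_Mapping.lookup k i) * Poly_Mapping.lookup f k"
  have eq: "(?t k when k - ?e = m) = (?t k when k = m + ?e)" for k
  proof (cases "Poly_Mapping.lookup k i = 0")
    case False
    then have "k - ?e + ?e = k"
      by (intro poly_mapping_eqI) (auto simp: lookup_add lookup_minus lookup_single when_def)
    then have "k - ?e = m \<longleftrightarrow> k = m + ?e"
      by (metis add_diff_cancel_right')
    then show ?thesis by simp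
  qed (simp add: when_def)
  have "Poly_Mapping.lookup (partial_deriv i f) m =
      (\<Sum>k\<in>Poly_Mapping.keys f. ?t k when k = m + ?e)"
    unfolding partial_deriv_def lookup_sum lookup_single by (simp only: eq)
  also have "\<dots> = ?t (m + ?e)"
    by (auto simp: when_def sum.delta in_keys_iff)
  finally show ?thesis
    by (simp add: lookup_add)
qed

lemma homogeneous_partial_deriv:
  assumes "homogeneous (Suc d) f"
  shows "homogeneous d (partial_deriv i f)"
  unfolding homogeneous_def
proof
  fix m assume "m \<in> Poly_Mapping.keys (partial_deriv i f)"
  then have "m + Poly_Mapping.single i 1 \<in> Poly_Mapping.keys f"
    by (auto simp: in_keys_iff lookup_partial_deriv)
  with assms have "(\<Sum>j\<in>UNIV. Poly_Mapping.lookup (m + Poly_Mapping.single i 1) j) = Suc d"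
    by (auto simp: homogeneous_def)
  then show "(\<Sum>j\<in>UNIV. Poly_Mapping.lookup m j) = d"
    by (simp add: lookup_add lookup_single sum.distrib when_def)
qed

lemma third_partial_deriv_constant:
  assumes "homogeneous 3 f"
  shows "partial_deriv i (partial_deriv j (partial_deriv k f)) =
    mconst (Poly_Mapping.lookup (partial_deriv i (partial_deriv j (partial_deriv k f))) 0)"
    (is "?g = _")
proof -
  have hom: "homogeneous 0 ?g"
    using assms by (intro homogeneous_partial_deriv) (simp add: numeral_3_eq_3)
  have "Poly_Mapping.lookup ?g m = 0" if "m \<noteq> 0" for m
  proof (rule ccontr)
    assume "Poly_Mapping.lookup ?g m \<noteq> 0"
    with hom have "m = 0"
      by (intro poly_mapping_eqI) (auto simp: homogeneous_def in_keys_iff)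
    with that show False by simp
  qed
  then show ?thesis
    by (intro poly_mapping_eqI) (auto simp: mconst_def lookup_single when_def)
qed

lemma mvar_power: "(mvar i :: ('a::comm_semiring_1, 'n) mpoly) ^ k =
    Poly_Mapping.single (Poly_Mapping.single i k) 1"
  by (induction k) (simp_all add: mvar_def mult_single single_add[symmetric])

lemma lin_subst_sum_of_cubes:
  "lin_subst A (sum_of_cubes :: ('a::comm_semiring_1, 'n::finite) mpoly) =
     (\<Sum>i\<in>UNIV. (\<Sum>j\<in>UNIV. mconst (A $ i $ j) * mvar j) ^ 3)"
proof -
  define c where "c = (\<lambda>i::'n. Poly_Mapping.single i (3::nat))"
  have inj: "inj c"
    by (rule injI) (metis c_def lookup_single_eq lookup_single_not_eq zero_neq_numeral)
  have P: "sum_of_cubes = (\<Sum>m\<in>range c. Poly_Mapping.single m (1::'a))"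
    unfolding sum_of_cubes_def mvar_power by (subst sum.reindex[OF inj]) (simp add: c_def)
  have l: "Poly_Mapping.lookup (sum_of_cubes :: ('a, 'n) mpoly) m = (if m \<in> range c then 1 else 0)" for m
    unfolding P lookup_sum lookup_single when_def by (auto simp: sum.delta)
  have k: "Poly_Mapping.keys (sum_of_cubes :: ('a, 'n) mpoly) = range c"
    by (rule set_eqI) (simp add: in_keys_iff l split: if_split)
  define s where "s = (\<lambda>i. \<Sum>j\<in>UNIV. mconst (A $ i $ j) * mvar j :: ('a, 'n) mpoly)"
  have s: "(\<Sum>j\<in>UNIV. mconst (A $ i $ j) * mvar j) = s i" for i
    by (simp add: s_def)
  have "(\<Prod>i'\<in>UNIV. s i' ^ Poly_Mapping.lookup (c i) i') = s i ^ 3" for i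
  proof -
    have "s i' ^ Poly_Mapping.lookup (c i) i' = (if i = i' then s i ^ 3 else 1)" for i'
      by (simp add: c_def lookup_single when_def)
    then show ?thesis by simp
  qed
  moreover have "mconst (1::'a) = (1 :: ('a, 'n) mpoly)"
    by (simp add: mconst_def)
  ultimately show ?thesis
    unfolding lin_subst_def msubst_def k s
    by (subst sum.reindex[OF inj]) (simp add: l)
qed

end

theory Submission
  imports Defs
begin

text \<open>
  If \<open>f = P\<^sub>3(Ax)\<close>, then \<open>T\<^sub>i = A\<^sup>T D\<^sub>i A\<close> where \<open>D\<^sub>i\<close> is diagonal with the \<open>i\<close>-th column of \<open>A\<close> on its
  diagonal. Hence \<open>Q = A\<^sup>-\<^sup>1\<close> diagonalizes all slices by congruence, and the combination of the slices
  with coefficient vector \<open>A\<^sup>-\<^sup>1(1,\<dots>,1)\<close> is \<open>A\<^sup>T A\<close>.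

  Conversely, let \<open>B = Q\<^sup>-\<^sup>1\<close> and \<open>T\<^sub>i = B\<^sup>T D\<^sub>i B\<close> with diagonal entries \<open>d\<^sub>i(l)\<close>. Since \<open>T\<^sub>i\<^sub>j\<^sub>k\<close> is symmetric
  in \<open>i\<close> and \<open>j\<close>, and \<open>B\<close> is invertible, \<open>d\<^sub>i(l) B\<^sub>l\<^sub>j = d\<^sub>j(l) B\<^sub>l\<^sub>i\<close>; thus \<open>d\<^sub>i(l) = c\<^sub>l B\<^sub>l\<^sub>i\<close>. The scalar \<open>c\<^sub>l\<close> is
  nonzero, for otherwise the \<open>l\<close>-th column of \<open>Q\<close> would be in the kernel of every matrix in the span.
  Scaling the rows of \<open>B\<close> by cube roots of the \<open>c\<^sub>l\<close> gives \<open>A\<close> such that \<open>P\<^sub>3(Ax)\<close> has the slices of \<open>f\<close>,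
  and a cubic form in characteristic zero is determined by its slices.
\<close>

section \<open>Formal derivatives and homogeneous polynomials\<close>

lemma partial_deriv_add: "partial_deriv i (f + g) = partial_deriv i f + partial_deriv i g"
  by (intro poly_mapping_eqI) (simp add: lookup_partial_deriv lookup_add algebra_simps)

lemma partial_deriv_0: "partial_deriv i 0 = 0"
  by (simp add: partial_deriv_def)

lemma partial_deriv_sum: "partial_deriv i (\<Sum>a\<in>S. f a) = (\<Sum>a\<in>S. partial_deriv i (f a))"
  by (induction S rule: infinite_finite_induct) (simp_all add: partial_deriv_add partial_deriv_0)

lemma partial_deriv_commute:
  "partial_deriv i (partial_deriv j f) = partial_deriv j (partial_deriv i f)"
proof (cases "i = j")
  case False
  then show ?thesis
    by (intro poly_mapping_eqI)
      (simp add: lookup_partial_deriv lookup_add lookup_single when_def ac_simps)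
qed simp

lemma partial_deriv_single:
  "partial_deriv i (Poly_Mapping.single m a) =
     Poly_Mapping.single (m - Poly_Mapping.single i 1) (of_nat (Poly_Mapping.lookup m i) * a)"
  by (cases "a = 0") (simp_all add: partial_deriv_def)

text \<open>Leibniz rule on monomials. Lowering one factor agrees with lowering the product only if
  the variable \<open>i\<close> occurs in that factor; where the exponent subtraction truncates, the
  coefficient is zero.\<close>

lemma partial_deriv_mult_single:
  fixes a b :: "'a::comm_semiring_1"
  shows "partial_deriv i (Poly_Mapping.single m a * Poly_Mapping.single n b) =
    partial_deriv i (Poly_Mapping.single m a) * Poly_Mapping.single n b +
    Poly_Mapping.single m a * partial_deriv i (Poly_Mapping.single n b)"
proof -
  let ?e = "Poly_Mapping.single i (1::nat)"
  have shift: "p - ?e + q = p + q - ?e" if "Poly_Mapping.lookup p i \<noteq> 0" for p q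
    using that
    by (intro poly_mapping_eqI) (auto simp: lookup_add lookup_minus lookup_single when_def)
  have l: "Poly_Mapping.single (p - ?e + q) (of_nat (Poly_Mapping.lookup p i) * c) =
      Poly_Mapping.single (p + q - ?e) (of_nat (Poly_Mapping.lookup p i) * c)" for p q and c :: 'a
    by (cases "Poly_Mapping.lookup p i = 0") (simp_all add: shift del: One_nat_def)
  show ?thesis
    using l[of m n "a * b"] l[of n m "a * b"]
    by (simp add: partial_deriv_single mult_single lookup_add single_add[symmetric] algebra_simps)
qed

lemma poly_mapping_sum_singles:
  "f = (\<Sum>m\<in>Poly_Mapping.keys f. Poly_Mapping.single m (Poly_Mapping.lookup f m))"
  by (intro poly_mapping_eqI)
    (auto simp: lookup_sum lookup_single when_def in_keys_iff sum.delta)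

lemma partial_deriv_mult:
  fixes f g :: "('a::comm_semiring_1, 'n) mpoly"
  shows "partial_deriv i (f * g) = partial_deriv i f * g + f * partial_deriv i g"
proof -
  \<comment> \<open>Both sides are biadditive, so the rule passes from summands to sums. Here
    \<open>F\<close> and \<open>G\<close> will be the monomials of \<open>f\<close> and
    \<open>g\<close>, and the sums are folded back afterwards.\<close>
  have aux: "partial_deriv i (sum F S * sum G R) =
      partial_deriv i (sum F S) * sum G R + sum F S * partial_deriv i (sum G R)"
    if "\<And>x y. partial_deriv i (F x * G y) = partial_deriv i (F x) * G y + F x * partial_deriv i (G y)"
    for F G :: "('n \<Rightarrow>\<^sub>0 nat) \<Rightarrow> ('a, 'n) mpoly" and S R
    by (simp add: sum_product partial_deriv_sum that sum.distrib)
  show ?thesis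
    using aux[OF partial_deriv_mult_single, of "\<lambda>m. m" "Poly_Mapping.lookup f" "Poly_Mapping.keys f"
        "\<lambda>m. m" "Poly_Mapping.lookup g" "Poly_Mapping.keys g"]
    by (simp only: poly_mapping_sum_singles[symmetric])
qed

lemma mconst_mult: "mconst (a * b) = mconst a * mconst b"
  by (simp add: mconst_def mult_single)

lemma lookup_mconst_0: "Poly_Mapping.lookup (mconst a) 0 = a"
  by (simp add: mconst_def)

lemma partial_deriv_mconst [simp]: "partial_deriv i (mconst a) = 0"
  by (simp add: mconst_def partial_deriv_single)

lemma partial_deriv_mvar: "partial_deriv i (mvar j) = (if i = j then mconst 1 else 0)"
  by (simp add: mvar_def mconst_def partial_deriv_single lookup_single when_def)

lemma partial_deriv_linear_form:
  "partial_deriv i (\<Sum>j\<in>UNIV. mconst (a j) * mvar j :: ('a::comm_semiring_1, 'n::finite) mpoly) =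
     mconst (a i)"
  by (simp add: partial_deriv_sum partial_deriv_mult partial_deriv_mvar if_distrib
      mconst_mult[symmetric] cong: if_cong)

text \<open>The first derivatives of \<open>L\<close> are constant, so only the terms
  differentiating each of the three factors once survive, one for each of the 6
  permutations.\<close>

lemma third_partial_deriv_cube:
  fixes L :: "('a::comm_semiring_1, 'n) mpoly"
  assumes "\<And>i. partial_deriv i L = mconst (a i)"
  shows "partial_deriv i (partial_deriv j (partial_deriv k (L ^ 3))) = mconst (6 * (a i * a j * a k))"
proof -
  have six: "mconst (6 * c) = mconst c + mconst c + mconst c + mconst c + mconst c + mconst c"
    for c :: 'a
  proof -
    have "(6::'a) = 1 + 1 + 1 + 1 + 1 + 1"
      by simp
    then have "6 * c = c + c + c + c + c + c"
      by (simp only: distrib_right mult_1)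
    then show ?thesis
      by (simp only: mconst_def single_add)
  qed
  show ?thesis
    unfolding six
    by (simp add: power3_eq_cube partial_deriv_mult partial_deriv_add assms mconst_mult algebra_simps)
qed

section \<open>Homogeneity, and recovering a form from its derivatives\<close>

lemma homogeneous_mult:
  fixes f g :: "('a::comm_semiring_1, 'n::finite) mpoly"
  assumes "homogeneous d f" "homogeneous e g"
  shows "homogeneous (d + e) (f * g)"
  using assms keys_mult[of f g] by (fastforce simp: homogeneous_def lookup_add sum.distrib)

lemma homogeneous_sum:
  assumes "\<And>a. a \<in> S \<Longrightarrow> homogeneous d (f a)"
  shows "homogeneous d (\<Sum>a\<in>S. f a :: ('a::comm_semiring_1, 'n::finite) mpoly)"
  using assms
proof (induction S rule: infinite_finite_induct)
  case (insert x F)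
  then show ?case
    using Poly_Mapping.keys_add[of "f x" "sum f F"] by (auto simp: homogeneous_def)
qed (simp_all add: homogeneous_def)

lemma homogeneous_linear_form:
  "homogeneous 1 (\<Sum>j\<in>UNIV. mconst (a j) * mvar j :: ('a::comm_semiring_1, 'n::finite) mpoly)"
  by (rule homogeneous_sum)
    (auto simp: homogeneous_def mconst_def mvar_def mult_single lookup_single when_def)

lemma homogeneous_lin_subst_sum_of_cubes:
  "homogeneous 3 (lin_subst A sum_of_cubes :: ('a::comm_semiring_1, 'n::finite) mpoly)"
proof -
  have "homogeneous (1 + 1 + 1) (L ^ 3)" if "homogeneous 1 L" for L :: "('a, 'n) mpoly"
    unfolding power3_eq_cube by (intro homogeneous_mult that)
  then show ?thesis
    unfolding lin_subst_sum_of_cubes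
    by (intro homogeneous_sum) (simp add: homogeneous_linear_form[simplified] numeral_3_eq_3)
qed

text \<open>If \<open>i\<close> occurs in \<open>m\<close>, the coefficient at \<open>m\<close> is
  read off from the derivative in \<open>i\<close> after division by a positive integer, nonzero in
  characteristic 0. The constant term vanishes because the degree is positive.\<close>

lemma homogeneous_eqI_partial_deriv:
  fixes f g :: "('a::field_char_0, 'n::finite) mpoly"
  assumes hom: "homogeneous (Suc d) f" "homogeneous (Suc d) g"
    and eq: "\<And>i. partial_deriv i f = partial_deriv i g"
  shows "f = g"
proof (rule poly_mapping_eqI)
  fix m
  show "Poly_Mapping.lookup f m = Poly_Mapping.lookup g m"
  proof (cases "m = 0")
    case True
    have "Poly_Mapping.lookup h 0 = 0" if "homogeneous (Suc d) h" for h :: "('a, 'n) mpoly"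
      using that by (force simp: homogeneous_def in_keys_iff)
    with hom True show ?thesis by simp
  next
    case False
    then obtain i where i: "Poly_Mapping.lookup m i \<noteq> 0"
      by (metis lookup_zero poly_mapping_eqI)
    have "m - Poly_Mapping.single i 1 + Poly_Mapping.single i 1 = m"
      using i by (intro poly_mapping_eqI) (auto simp: lookup_add lookup_minus lookup_single when_def)
    then show ?thesis
      using arg_cong[OF eq[of i], of "\<lambda>p. Poly_Mapping.lookup p (m - Poly_Mapping.single i 1)"]
      by (simp add: lookup_partial_deriv del: of_nat_Suc)
  qed
qed


section \<open>Slices of cubic forms\<close>

lemma slice_swap: "slice f i $ j $ k = slice f j $ i $ k"
  by (simp add: slice_def partial_deriv_commute[of i j])

text \<open>The factor \<open>1 / 6\<close> cancels the 6 from differentiating a cube, so row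
  \<open>l\<close> of \<open>A\<close> contributes its own threefold tensor power.\<close>

lemma slice_lin_subst:
  fixes A :: "'a::field_char_0^'n::finite^'n"
  shows "slice (lin_subst A sum_of_cubes) i $ j $ k = (\<Sum>l\<in>UNIV. A $ l $ i * A $ l $ j * A $ l $ k)"
  unfolding slice_def lin_subst_sum_of_cubes
  by (simp add: partial_deriv_sum third_partial_deriv_cube[OF partial_deriv_linear_form]
      lookup_sum lookup_mconst_0 sum_distrib_left[symmetric])

lemma cubic_form_eqI_slice:
  fixes f g :: "('a::field_char_0, 'n::finite) mpoly"
  assumes hom: "homogeneous 3 f" "homogeneous 3 g" and eq: "slice f = slice g"
  shows "f = g"
proof -
  have "partial_deriv i (partial_deriv j (partial_deriv k f)) =
      partial_deriv i (partial_deriv j (partial_deriv k g))" for i j k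
  proof -
    have "slice f i $ j $ k = slice g i $ j $ k"
      by (simp add: eq)
    then show ?thesis
      using third_partial_deriv_constant[OF hom(1), of i j k]
        third_partial_deriv_constant[OF hom(2), of i j k]
      by (simp add: slice_def)
  qed
  then show ?thesis
    \<comment> \<open>Descend from equal third derivatives: the second derivatives agree in degree
      1, then the first in degree 2, then the forms in degree 3.\<close>
    using hom unfolding numeral_3_eq_3
    by (blast intro: homogeneous_eqI_partial_deriv homogeneous_partial_deriv)
qed


section \<open>Simultaneous diagonalization by congruence\<close>

lemma congruence_diagonal_nth:
  fixes D B :: "'a::comm_semiring_1^'n::finite^'n"
  assumes "diagonal_matrix D"
  shows "(transpose B ** D ** B) $ j $ k = (\<Sum>l\<in>UNIV. D $ l $ l * B $ l $ j * B $ l $ k)"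
proof -
  have "(\<Sum>p\<in>UNIV. B $ p $ j * D $ p $ l) = B $ l $ j * D $ l $ l" for l
    using assms by (subst sum.remove[of _ l]) (auto simp: diagonal_matrix_def intro!: sum.neutral)
  then show ?thesis
    by (simp add: matrix_matrix_mult_def transpose_def ac_simps)
qed

lemma congruence_inverse:
  fixes Q B M :: "'a::comm_semiring_1^'n::finite^'n"
  assumes "Q ** B = mat 1"
  shows "transpose B ** (transpose Q ** M ** Q) ** B = M"
proof -
  have "transpose B ** transpose Q = mat 1"
    by (metis assms matrix_transpose_mul transpose_mat)
  then show ?thesis
    by (metis assms matrix_mul_assoc matrix_mul_lid matrix_mul_rid)
qed

text \<open>The sums are the entries of the row vectors \<open>u B\<close> and \<open>v B\<close>;
  multiplying on the right by \<open>C\<close> recovers \<open>u\<close> and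
  \<open>v\<close>.\<close>

lemma right_mult_cancel_sum:
  fixes B C :: "'a::comm_semiring_1^'n::finite^'n"
  assumes "B ** C = mat 1" and "\<And>k. (\<Sum>l\<in>UNIV. u l * B $ l $ k) = (\<Sum>l\<in>UNIV. v l * B $ l $ k)"
  shows "u l = v l"
proof -
  have "(\<chi> l. u l) v* B = (\<chi> l. v l) v* B"
    using assms(2) by (simp add: vector_matrix_mult_def vec_eq_iff mult.commute)
  then have "(\<chi> l. u l) v* (B ** C) = (\<chi> l. v l) v* (B ** C)"
    by (simp only: vector_matrix_mul_assoc[symmetric])
  then show ?thesis
    by (simp add: assms(1) vec_eq_iff)
qed

section \<open>The two directions of the equivalence\<close>

lemma equivalent_to_sum_of_cubesD:
  fixes f :: "('a::field_char_0, 'n::finite) mpoly"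
  assumes "equivalent_to_sum_of_cubes f"
  shows "\<exists>M \<in> mat_span (range (slice f)). invertible M"
    and "\<exists>Q :: 'a^'n^'n. invertible Q \<and> (\<forall>i. diagonal_matrix (transpose Q ** slice f i ** Q))"
proof -
  interpret V: vector_space "mat_scale :: 'a \<Rightarrow> 'a^'n^'n \<Rightarrow> 'a^'n^'n"
    by (rule vector_space_mat_scale)
  obtain A Q :: "'a^'n^'n" where f: "f = lin_subst A sum_of_cubes"
    and AQ: "A ** Q = mat 1" and QA: "Q ** A = mat 1"
    using assms by (auto simp: equivalent_to_sum_of_cubes_def invertible_def)
  have inv: "invertible A" "invertible Q"
    using AQ QA by (auto simp: invertible_def)
  define D where "D i = (\<chi> l m. if l = m then A $ l $ i else 0)" for i
  have diag: "diagonal_matrix (D i)" for i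
    by (simp add: diagonal_matrix_def D_def)
  have slice: "slice f i = transpose A ** D i ** A" for i
    by (simp add: vec_eq_iff f slice_lin_subst congruence_diagonal_nth[OF diag]) (simp add: D_def)
  have "transpose Q ** slice f i ** Q = D i" for i
    unfolding slice using AQ by (rule congruence_inverse)
  with inv diag show "\<exists>Q :: 'a^'n^'n. invertible Q \<and>
      (\<forall>i. diagonal_matrix (transpose Q ** slice f i ** Q))"
    by metis
  define c where "c = Q *v 1"
  have "A *v c = 1"
    by (simp add: c_def matrix_vector_mul_assoc AQ)
  then have c: "(\<Sum>i\<in>UNIV. c $ i * A $ l $ i) = 1" for l
    by (simp add: matrix_vector_mult_def vec_eq_iff mult.commute)
  have "(\<Sum>i\<in>UNIV. mat_scale (c $ i) (slice f i)) = transpose A ** A"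
  proof -
    have "(\<Sum>i\<in>UNIV. mat_scale (c $ i) (slice f i)) $ j $ k = (transpose A ** A) $ j $ k" for j k
    proof -
      have "(\<Sum>i\<in>UNIV. mat_scale (c $ i) (slice f i)) $ j $ k =
          (\<Sum>i\<in>UNIV. \<Sum>l\<in>UNIV. c $ i * A $ l $ i * (A $ l $ j * A $ l $ k))"
        by (simp add: mat_scale_def f slice_lin_subst sum_distrib_left ac_simps)
      \<comment> \<open>Exchanging the sums isolates entry \<open>l\<close> of
        \<open>A *v c\<close>, which is 1.\<close>
      also have "\<dots> = (\<Sum>l\<in>UNIV. (\<Sum>i\<in>UNIV. c $ i * A $ l $ i) * (A $ l $ j * A $ l $ k))"
        by (subst sum.swap) (simp add: sum_distrib_right)
      finally show ?thesis
        by (simp add: c matrix_matrix_mult_def transpose_def)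
    qed
    then show ?thesis by (simp add: vec_eq_iff)
  qed
  moreover have "(\<Sum>i\<in>UNIV. mat_scale (c $ i) (slice f i)) \<in> mat_span (range (slice f))"
    unfolding mat_span_def by (intro V.span_sum V.span_scale V.span_base) simp
  moreover have "invertible (transpose A ** A)"
    using inv by (metis invertible_def invertible_mult matrix_transpose_mul transpose_mat)
  ultimately show "\<exists>M \<in> mat_span (range (slice f)). invertible M"
    by metis
qed

text \<open>The matrices annihilating \<open>v\<close> form a subspace, so it contains the whole
  span and with it the invertible \<open>M\<close>.\<close>

lemma mat_span_common_kernel:
  fixes v :: "'a::field^'n::finite"
  assumes "\<And>S :: 'a^'n^'n. S \<in> X \<Longrightarrow> S *v v = 0" and M: "M \<in> mat_span X" "invertible M"
  shows "v = 0"
proof -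
  interpret V: vector_space "mat_scale :: 'a \<Rightarrow> 'a^'n^'n \<Rightarrow> 'a^'n^'n"
    by (rule vector_space_mat_scale)
  have scale: "mat_scale c S *v v = c *s (S *v v)" for c and S :: "'a^'n^'n"
    by (simp add: mat_scale_def matrix_vector_mult_def vec_eq_iff sum_distrib_left mult.assoc)
  have "V.subspace {S. S *v v = 0}"
    by (rule V.subspaceI) (simp_all add: matrix_vector_mult_add_rdistrib scale)
  then have "M *v v = 0"
    using V.span_minimal[of X "{S. S *v v = 0}"] assms by (auto simp: mat_span_def)
  with \<open>invertible M\<close> show "v = 0"
    by (metis invertible_def matrix_left_invertible_ker)
qed

lemma equivalent_to_sum_of_cubesI:
  fixes f :: "('a::field_char_0, 'n::finite) mpoly"
  assumes cube_root: "\<And>x::'a. \<exists>y. y ^ 3 = x"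
    and hom: "homogeneous 3 f"
    and M: "M \<in> mat_span (range (slice f))" "invertible M"
    and Q: "invertible (Q :: 'a^'n^'n)"
    and diag: "\<And>i. diagonal_matrix (transpose Q ** slice f i ** Q)"
  shows "equivalent_to_sum_of_cubes f"
proof -
  obtain B where QB: "Q ** B = mat 1" and BQ: "B ** Q = mat 1"
    using Q by (auto simp: invertible_def)
  define d where "d i l = (transpose Q ** slice f i ** Q) $ l $ l" for i l
  have slice: "slice f i $ j $ k = (\<Sum>l\<in>UNIV. d i l * B $ l $ j * B $ l $ k)" for i j k
    unfolding d_def
    by (simp only: congruence_diagonal_nth[OF diag, symmetric] congruence_inverse[OF QB])
  have sym: "d i l * B $ l $ j = d j l * B $ l $ i" for i j l
  proof -
    have "(\<Sum>l\<in>UNIV. d i l * B $ l $ j * B $ l $ k) = (\<Sum>l\<in>UNIV. d j l * B $ l $ i * B $ l $ k)" for k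
      using slice_swap[of f i j k] by (simp only: slice)
    then show ?thesis
      by (rule right_mult_cancel_sum[OF BQ])
  qed
  \<comment> \<open>Row \<open>l\<close> of the invertible \<open>B\<close> has a nonzero entry, at
    \<open>j\<close> say; then \<open>sym\<close> makes \<open>d j l / B $ l $ j\<close> the
    proportionality factor for every \<open>i\<close>.\<close>
  have "\<exists>c. \<forall>i. d i l = c * B $ l $ i" for l
  proof -
    have "(\<Sum>j\<in>UNIV. B $ l $ j * Q $ j $ l) = 1"
      using arg_cong[OF BQ, of "\<lambda>X. X $ l $ l"] by (simp add: matrix_matrix_mult_def mat_def)
    then obtain j where "B $ l $ j \<noteq> 0"
      by (metis (no_types, lifting) mult_zero_left sum.neutral zero_neq_one)
    then have "\<forall>i. d i l = d j l / B $ l $ j * B $ l $ i"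
      using sym[of _ l j] by (simp add: field_simps)
    then show ?thesis by blast
  qed
  then obtain c where d: "d i l = c l * B $ l $ i" for i l
    by metis
  have nz: "c l \<noteq> 0" for l
  proof
    assume 0: "c l = 0"
    have BQ': "(\<Sum>k\<in>UNIV. B $ p $ k * Q $ k $ l) = (if p = l then 1 else 0)" for p
      using arg_cong[OF BQ, of "\<lambda>X. X $ p $ l"] by (simp add: matrix_matrix_mult_def mat_def)
    have "slice f i *v column l Q = 0" for i
    proof -
      \<comment> \<open>\<open>B\<close> sends column \<open>l\<close> of \<open>Q\<close> to the
        \<open>l\<close>-th unit vector, so one summand of the slice survives.\<close>
      have "(slice f i *v column l Q) $ j = d i l * B $ l $ j" for j
      proof -
        have "(slice f i *v column l Q) $ j =
            (\<Sum>k\<in>UNIV. \<Sum>p\<in>UNIV. d i p * B $ p $ j * (B $ p $ k * Q $ k $ l))"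
          by (simp add: matrix_vector_mult_def column_def slice sum_distrib_right mult.assoc)
        also have "\<dots> = (\<Sum>p\<in>UNIV. d i p * B $ p $ j * (\<Sum>k\<in>UNIV. B $ p $ k * Q $ k $ l))"
          by (subst sum.swap) (simp add: sum_distrib_left)
        finally show ?thesis
          by (simp add: BQ' if_distrib cong: if_cong)
      qed
      then show ?thesis
        by (simp add: vec_eq_iff d 0)
    qed
    then have "S *v column l Q = 0" if "S \<in> range (slice f)" for S
      using that by blast
    then have "column l Q = 0"
      using M by (rule mat_span_common_kernel)
    then have "Q $ k $ l = 0" for k
      by (simp add: column_def vec_eq_iff)
    with BQ'[of l] show False by simp
  qed
  define \<mu> where "\<mu> l = (SOME y. y ^ 3 = c l)" for l
  have \<mu>: "\<mu> l ^ 3 = c l" for l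
    unfolding \<mu>_def by (rule someI_ex) (rule cube_root)
  with nz have \<mu>_nz: "\<mu> l \<noteq> 0" for l
    by (metis power_eq_0_iff zero_less_numeral)
  define A where "A = (\<chi> l i. \<mu> l * B $ l $ i)"
  \<comment> \<open>\<open>A\<close> is diag(\<mu>) \<open>B\<close>, so its inverse is
    \<open>Q\<close> diag(1/\<mu>).\<close>
  have "A ** (\<chi> i l. Q $ i $ l / \<mu> l) = mat 1"
  proof -
    have "(A ** (\<chi> i l. Q $ i $ l / \<mu> l)) $ p $ q = \<mu> p / \<mu> q * (B ** Q) $ p $ q" for p q
      by (simp add: A_def matrix_matrix_mult_def sum_distrib_left mult.assoc)
    then show ?thesis
      using \<mu>_nz by (simp add: BQ vec_eq_iff mat_def)
  qed
  then have "invertible A"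
    using matrix_left_right_inverse unfolding invertible_def by blast
  moreover have "slice f i $ j $ k = slice (lin_subst A sum_of_cubes) i $ j $ k" for i j k
    unfolding slice slice_lin_subst d A_def
    by (simp add: \<mu>[symmetric] power3_eq_cube ac_simps)
  then have "f = lin_subst A sum_of_cubes"
    by (intro cubic_form_eqI_slice hom homogeneous_lin_subst_sum_of_cubes) (simp add: vec_eq_iff fun_eq_iff)
  ultimately show ?thesis
    by (auto simp: equivalent_to_sum_of_cubes_def)
qed

text \<open>The existence of cube roots is the property shared by the real and complex fields that
  lets one argument serve both.\<close>

lemma equivalent_to_sum_of_cubes_iff:
  fixes f :: "('a::field_char_0, 'n::finite) mpoly"
  assumes "\<And>x::'a. \<exists>y. y ^ 3 = x" and "homogeneous 3 f"
  shows "equivalent_to_sum_of_cubes f \<longleftrightarrow>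
    (\<exists>M \<in> mat_span (range (slice f)). invertible M) \<and>
    (\<exists>Q :: 'a^'n^'n. invertible Q \<and> (\<forall>i. diagonal_matrix (transpose Q ** slice f i ** Q)))"
  using equivalent_to_sum_of_cubesD[of f] equivalent_to_sum_of_cubesI[of f] assms by blast

theorem theorem3p6:
  shows "(\<forall>f :: (real, 'n::finite) mpoly. homogeneous 3 f \<longrightarrow>
            (equivalent_to_sum_of_cubes f \<longleftrightarrow>
              (\<exists>M \<in> mat_span (range (slice f)). invertible M) \<and>
              (\<exists>Q :: real^'n^'n. invertible Q \<and>
                 (\<forall>i. diagonal_matrix (transpose Q ** slice f i ** Q)))))
       \<and> (\<forall>f :: (complex, 'n::finite) mpoly. homogeneous 3 f \<longrightarrow>
            (equivalent_to_sum_of_cubes f \<longleftrightarrow>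
              (\<exists>M \<in> mat_span (range (slice f)). invertible M) \<and>
              (\<exists>Q :: complex^'n^'n. invertible Q \<and>
                 (\<forall>i. diagonal_matrix (transpose Q ** slice f i ** Q)))))"
proof -
  \<comment> \<open>Since 3 is odd, \<open>root 3\<close> also inverts cubing on negative
    reals.\<close>
  have "\<exists>y. y ^ 3 = x" for x :: real
    by (rule exI[of _ "root 3 x"]) (simp add: odd_real_root_pow)
  moreover have "\<exists>y. y ^ 3 = z" for z :: complex
  proof (cases "z = 0")
    case False
    then have "exp (Ln z / 3) ^ 3 = z"
      by (simp flip: exp_of_nat_mult)
    then show ?thesis by blast
  qed auto
  ultimately show ?thesis
    by (intro conjI allI impI equivalent_to_sum_of_cubes_iff)
qed

end
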